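(* If $n$ is a non-negative integer and $p$ and $q$ are non-zero integers, then $$\sum_{k=0}^n(-1)^{(p-q)(n-k)}\frac{n}{n+k}\binom{n+k}{n-k}\left(\frac{F_{p+q}F_{p-q}}{F_pF_q}\right)^{2k}=\frac{F_p^{4n}+F_q^{4n}}{2F_q^{2n}F_p^{2n}}.$$
   Context: $F_n$ ($n\in\mathbb{Z}$) are the Fibonacci numbers: $F_0=0$, $F_1=1$, $F_n=F_{n-1}+F_{n-2}$, extended to negative indices by $F_{-n}=(-1)^{n-1}F_n$. The coefficient $\frac{n}{n+k}\binom{n+k}{n-k}$ equals $\binom{n+k-1}{k}\binom{n}{k}/\binom{2k}{k}$; for $n=k=0$ it is understood to be $1$. The convention $0^0=1$ is used. *)

theory Defs
  imports Complex_Main "HOL-Number_Theory.Fib"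
begin

text \<open>Fibonacci numbers at integer indices, with \<open>F (-n) = (-1)^(n-1) * F n\<close> for \<open>n > 0\<close>.\<close>

definition F :: "int \<Rightarrow> int" where
  "F m = (if m \<ge> 0 then int (fib (nat m))
          else (-1) ^ (nat (- m) - 1) * int (fib (nat (- m))))"

lemma F_rec: "F m = F (m - 1) + F (m - 2)"
proof -
  consider (pos) k where "m = int k + 2" | (one) "m = 1" | (zero) "m = 0" | (neg) k where "m = - int (Suc k)"
  proof -
    have "m \<ge> 2 \<or> m = 1 \<or> m = 0 \<or> m < 0" by linarith
    moreover have "m = int (nat (m - 2)) + 2" if "m \<ge> 2" using that by simp
    moreover have "m = - int (Suc (nat (- m - 1)))" if "m < 0" using that by simp
    ultimately show ?thesis using that by blast
  qed
  then show ?thesis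
  proof cases
    case (pos k)
    then have "nat m = Suc (Suc k)" "nat (m - 1) = Suc k" "nat (m - 2) = k" by auto
    with pos show ?thesis by (simp add: F_def)
  next
    case (neg k)
    then have "nat (- m) = Suc k" "nat (- (m - 1)) = Suc (Suc k)"
      "nat (- (m - 2)) = Suc (Suc (Suc k))" by auto
    with neg show ?thesis by (simp add: F_def algebra_simps)
  qed (simp_all add: F_def)
qed

text \<open>The case distinction is needed because \<open>0 / 0 = 0\<close> in HOL, whereas the coefficient
  is \<open>1\<close> for \<open>n = k = 0\<close>.\<close>

definition coef :: "nat \<Rightarrow> nat \<Rightarrow> real" where
  "coef n k = (if n = 0 \<and> k = 0 then 1
     else real n / real (n + k) * real ((n + k) choose (n - k)))"

lemma coef_alt:
  assumes "k \<le> n"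
  shows "coef n k = real ((n + k - 1) choose k) * real (n choose k) / real ((2 * k) choose k)"
proof (cases n)
  case 0
  with assms show ?thesis by (simp add: coef_def)
next
  case (Suc m)
  have 1: "real ((n + k) choose (n - k)) = fact (n + k) / (fact (n - k) * fact (2 * k))"
    using assms by (subst binomial_fact) (auto simp: mult_2)
  have 2: "real ((n + k - 1) choose k) = fact (n + k - 1) / (fact k * fact m)"
    using Suc by (subst binomial_fact) auto
  have 3: "real (n choose k) = fact n / (fact k * fact (n - k))"
    using assms by (rule binomial_fact)
  have 4: "real ((2 * k) choose k) = fact (2 * k) / (fact k * fact k)"
    by (subst binomial_fact) (auto simp: mult_2)
  have 5: "fact (n + k) = real (n + k) * fact (n + k - 1)"
    using Suc by (simp add: fact_reduce)
  have 6: "fact n = real n * fact m"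
    using Suc by simp
  have nz: "real (n + k) \<noteq> 0" using Suc by simp
  have "coef n k = real n / real (n + k) * real ((n + k) choose (n - k))"
    using Suc by (simp add: coef_def)
  also have "\<dots> = real n * fact (n + k - 1) / (fact (n - k) * fact (2 * k))"
    unfolding 1 5 using nz by (simp del: of_nat_add)
  also have "\<dots> = real ((n + k - 1) choose k) * real (n choose k) / real ((2 * k) choose k)"
    unfolding 2 3 4 6 by (simp add: divide_simps)
  finally show ?thesis .
qed

end

theory Submission imports Defs
begin

text \<open>By Catalan's identity the base of the powers is \<open>u - e / u\<close> with \<open>u = F p / F q\<close> and
  \<open>e = (-1)^(p-q)\<close>. Since \<open>e = 1 / e\<close>, the sum is \<open>e^n\<close> times a polynomial in
  \<open>y = e * (u - e / u)\<^sup>2 = w - 2 + 1 / w\<close> with \<open>w = e * u\<^sup>2\<close>. Up to the factor \<open>2\<close> these polynomials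
  satisfy the recurrence \<open>L (n+2) = (y + 2) * L (n+1) - L n\<close>, whose solution is
  \<open>L n = w^n + 1 / w^n\<close>.\<close>

text \<open>Division-free form of twice \<open>coef\<close>, suited to Pascal's rule. At
  \<open>n = k = 0\<close> truncated subtraction makes both binomials \<open>1\<close>, which
  matches the convention for \<open>coef\<close>.\<close>

definition lucas_coef :: "nat \<Rightarrow> nat \<Rightarrow> nat" where
  "lucas_coef n k = ((n + k) choose (2 * k)) + ((n + k - 1) choose (2 * k))"

lemma coef_eq_lucas_coef:
  assumes "k \<le> n"
  shows "2 * coef n k = real (lucas_coef n k)"
proof (cases "n = 0")
  case True
  with assms show ?thesis by (simp add: coef_def lucas_coef_def)
next
  case False
  then obtain m where m: "n + k = Suc m" by (metis add_is_0 not0_implies_Suc)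
  have sym: "(n + k) choose (n - k) = (n + k) choose (2 * k)"
    using assms binomial_symmetric[of "n - k" "n + k"] by (simp add: mult_2)
  \<comment> \<open>Absorption relates the two binomials of \<open>lucas_coef\<close>; adding
    \<open>n + k\<close> times the first one to both sides produces the factor
    \<open>2 * n\<close>.\<close>
  have "(Suc m - 2 * k) * (Suc m choose (2 * k)) = Suc m * (m choose (2 * k))"
    by (metis binomial_absorb_comp diff_Suc_1)
  moreover have "Suc m - 2 * k = n - k" using m by simp
  ultimately have "real (n - k) * real (Suc m choose (2 * k)) = real (Suc m) * real (m choose (2 * k))"
    by (metis of_nat_mult)
  then have "(real n - real k) * real ((n + k) choose (2 * k))
      = (real n + real k) * real ((n + k - 1) choose (2 * k))"
    using assms by (simp add: m of_nat_diff flip: of_nat_add)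
  then have "2 * real n * real ((n + k) choose (2 * k)) = (real n + real k) * real (lucas_coef n k)"
    unfolding lucas_coef_def of_nat_add by (simp only: algebra_simps)
  with False show ?thesis unfolding coef_def sym by (simp add: field_simps)
qed

lemma lucas_coef_eq_0: "n < k \<Longrightarrow> lucas_coef n k = 0"
  by (simp add: lucas_coef_def)

lemma lucas_coef_0 [simp]: "lucas_coef n 0 = 2"
  by (simp add: lucas_coef_def)

text \<open>Pascal's rule applied twice shows that the second difference of
  \<open>N choose (j + 2)\<close> in \<open>N\<close> is \<open>N choose j\<close>; this is used for
  \<open>j = 2 * k\<close> with \<open>N = n + k + 1\<close> and \<open>N = n + k\<close>.\<close>

lemma lucas_coef_rec:
  "lucas_coef (Suc (Suc n)) (Suc k) + lucas_coef n (Suc k)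
    = lucas_coef (Suc n) k + 2 * lucas_coef (Suc n) (Suc k)"
  by (simp add: lucas_coef_def)

lemma lucas_poly_rec:
  fixes y :: "'a::comm_ring_1"
  defines "L \<equiv> \<lambda>n. \<Sum>k\<le>n. of_nat (lucas_coef n k) * y ^ k"
  shows "L (Suc (Suc n)) = (y + 2) * L (Suc n) - L n"
proof -
  \<comment> \<open>Vanishing coefficients pad the three sums to a common range; splitting off the
    constant term \<open>2\<close> leaves the indices to which \<open>lucas_coef_rec\<close>
    applies.\<close>
  have ext: "L m = 2 + (\<Sum>k\<le>N. of_nat (lucas_coef m (Suc k)) * y ^ Suc k)" if "m \<le> Suc N" for m N
  proof -
    have "L m = (\<Sum>k\<le>Suc N. of_nat (lucas_coef m k) * y ^ k)"
      unfolding L_def using that by (intro sum.mono_neutral_left) (auto simp: lucas_coef_eq_0)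
    then show ?thesis by (simp add: sum.atMost_Suc_shift del: sum.atMost_Suc power_Suc)
  qed
  have rec: "of_nat (lucas_coef (Suc (Suc n)) (Suc k)) =
      (of_nat (lucas_coef (Suc n) k) + 2 * of_nat (lucas_coef (Suc n) (Suc k))
        - of_nat (lucas_coef n (Suc k)) :: 'a)" for k
    using arg_cong[OF lucas_coef_rec[of n k], of "of_nat :: nat \<Rightarrow> 'a"] by (simp add: algebra_simps)
  have "L (Suc (Suc n)) = 2 + (\<Sum>k\<le>Suc n. of_nat (lucas_coef (Suc (Suc n)) (Suc k)) * y ^ Suc k)"
    by (rule ext) simp
  also have "\<dots> = 2 + (y * L (Suc n)
      + 2 * (\<Sum>k\<le>Suc n. of_nat (lucas_coef (Suc n) (Suc k)) * y ^ Suc k)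
      - (\<Sum>k\<le>Suc n. of_nat (lucas_coef n (Suc k)) * y ^ Suc k))"
    unfolding L_def rec sum_distrib_left sum.distrib[symmetric] sum_subtractf[symmetric]
    by (intro arg_cong2[where f = "(+)"] sum.cong refl) (simp add: algebra_simps)
  also have "\<dots> = (y + 2) * L (Suc n) - L n"
    using ext[of "Suc n" "Suc n"] ext[of n "Suc n"] by (simp add: algebra_simps)
  finally show ?thesis .
qed

text \<open>For \<open>y = w - 2 + 1 / w\<close> the characteristic polynomial
  \<open>t^2 - (y + 2) * t + 1\<close> has roots \<open>w\<close> and \<open>1 / w\<close>, and the
  values at \<open>n = 0\<close> and \<open>n = 1\<close> agree.\<close>

lemma lucas_poly_closed_form:
  fixes w :: "'a::field"
  assumes "w \<noteq> 0"
  shows "(\<Sum>k\<le>n. of_nat (lucas_coef n k) * (w - 2 + 1 / w) ^ k) = w ^ n + 1 / w ^ n"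
proof (induction n rule: induct_nat_012)
  case 0
  show ?case by simp
next
  case 1
  show ?case by (simp add: lucas_coef_def numeral_2_eq_2)
next
  case (ge2 n)
  show ?case
    unfolding lucas_poly_rec ge2 using assms by (simp add: field_simps)
qed

text \<open>Binet's formula: the hypotheses make \<phi> and \<psi> the roots of
  \<open>t^2 = t + 1\<close>.\<close>

lemma F_closed_form:
  fixes \<phi> \<psi> :: real
  assumes "\<phi> + \<psi> = 1" and "\<phi> * \<psi> = -1"
  shows "real_of_int (F m) * (\<phi> - \<psi>) = \<phi> powi m - \<psi> powi m"
proof -
  have sq: "\<phi> ^ 2 = \<phi> + 1" "\<psi> ^ 2 = \<psi> + 1"
    using assms by algebra+
  have nz: "\<phi> \<noteq> 0" "\<psi> \<noteq> 0" using assms by auto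
  have inv: "inverse \<phi> = - \<psi>" "inverse \<psi> = - \<phi>"
    using assms nz by (auto simp: field_simps)
  have nat: "real (fib k) * (\<phi> - \<psi>) = \<phi> ^ k - \<psi> ^ k" for k
  proof (induction k rule: fib.induct)
    case (3 k)
    have "\<phi> ^ Suc (Suc k) = \<phi> ^ Suc k + \<phi> ^ k" "\<psi> ^ Suc (Suc k) = \<psi> ^ Suc k + \<psi> ^ k"
      using sq by (simp_all add: power2_eq_square algebra_simps flip: mult.assoc)
    with 3 show ?case by (simp add: distrib_right del: power_Suc)
  qed simp_all
  show ?thesis
  proof (cases "m \<ge> 0")
    case True
    then show ?thesis by (simp add: F_def nat power_int_def)
  next
    case False
    define k where "k = nat (- m) - 1"
    have k: "nat (- m) = Suc k" using False by (simp add: k_def)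
    \<comment> \<open>Inversion sends each root to minus the other, so the right-hand side is the
      difference of the powers with exponent \<open>- Suc k\<close>.\<close>
    have "(real (fib (Suc k)) * (\<phi> - \<psi>)) * (- 1) ^ k = (- \<psi>) ^ Suc k - (- \<phi>) ^ Suc k"
      unfolding nat by (simp add: power_minus[of \<phi>] power_minus[of \<psi>] algebra_simps)
    with False show ?thesis
      by (simp add: F_def power_int_def k inv mult_ac del: power_Suc fib.simps)
  qed
qed

text \<open>Binet's formula, together with \<open>-1\<close> being the product of the roots, turns
  Catalan's identity into a rational identity in \<open>a\<close>, \<open>b\<close>,
  \<open>c\<close>, \<open>d\<close>.\<close>

lemma F_catalan:
  "real_of_int (F (p + q) * F (p - q))
    = real_of_int (F p) ^ 2 - (-1) powi (p - q) * real_of_int (F q) ^ 2"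
proof -
  define \<phi> \<psi> :: real where "\<phi> = (1 + sqrt 5) / 2" and "\<psi> = (1 - sqrt 5) / 2"
  have *: "\<phi> + \<psi> = 1" "\<phi> * \<psi> = -1" and D: "\<phi> - \<psi> \<noteq> 0"
    by (simp_all add: \<phi>_def \<psi>_def field_simps)
  have nz: "\<phi> \<noteq> 0" "\<psi> \<noteq> 0" using * by auto
  define a b c d where "a = \<phi> powi p" and "b = \<psi> powi p" and "c = \<phi> powi q" and "d = \<psi> powi q"
  have nz': "c \<noteq> 0" "d \<noteq> 0" using nz by (simp_all add: c_def d_def)
  have ab: "(-1) powi p = a * b" and cd: "(-1) powi q = c * d"
    unfolding a_def b_def c_def d_def power_int_mult_distrib[symmetric] * by simp_all
  have cd2: "c * d * (c * d) = 1"
    unfolding cd[symmetric] by (simp flip: power_int_mult_distrib)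
  have s: "(-1) powi (p - q) = a * b / (c * d)"
    by (simp add: power_int_diff ab cd)
  have cf: "real_of_int (F p) * (\<phi> - \<psi>) = a - b" "real_of_int (F q) * (\<phi> - \<psi>) = c - d"
    "real_of_int (F (p + q)) * (\<phi> - \<psi>) = a * c - b * d"
    "real_of_int (F (p - q)) * (\<phi> - \<psi>) = a / c - b / d"
    using nz by (simp_all add: F_closed_form[OF *] power_int_add power_int_diff a_def b_def c_def d_def)
  have "real_of_int (F (p + q) * F (p - q)) * (\<phi> - \<psi>) ^ 2 = (a * c - b * d) * (a / c - b / d)"
    unfolding cf[symmetric] by (simp add: power2_eq_square)
  also have "\<dots> = (a - b) ^ 2 - a * b / (c * d) * (c - d) ^ 2"
    using nz' by (simp add: field_simps power2_eq_square)
  also have "\<dots> = (real_of_int (F p) ^ 2 - (-1) powi (p - q) * real_of_int (F q) ^ 2) * (\<phi> - \<psi>) ^ 2"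
    unfolding s cf[symmetric] power_mult_distrib by (simp add: left_diff_distrib mult.assoc)
  finally show ?thesis using D by simp
qed

lemma F_eq_0_iff [simp]: "F m = 0 \<longleftrightarrow> m = 0"
  using fib_neq_0_nat[of "nat m"] fib_neq_0_nat[of "nat (- m)"]
  by (cases m "0::int" rule: linorder_cases) (auto simp: F_def)

theorem theorem12:
  fixes n :: nat and p q :: int
  assumes "p \<noteq> 0" and "q \<noteq> 0"
  shows "(\<Sum>k=0..n. (-1) powi ((p - q) * (int n - int k)) * coef n k *
            (real_of_int (F (p + q) * F (p - q)) / real_of_int (F p * F q)) ^ (2 * k))
       = real_of_int (F p ^ (4 * n) + F q ^ (4 * n)) /
         real_of_int (2 * F q ^ (2 * n) * F p ^ (2 * n))"
proof -
  define a b e :: real where "a = F p" and "b = F q" and "e = (-1) powi (p - q)"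
  have nz: "a \<noteq> 0" "b \<noteq> 0" using assms by (simp_all add: a_def b_def)
  have ee: "e * e = 1" by (simp add: e_def flip: power_int_mult_distrib)
  then have e: "e \<noteq> 0" "inverse e = e" "e ^ m * e ^ m = 1" for m
    by (auto simp: inverse_unique simp flip: power_mult_distrib)
  define x w where "x = real_of_int (F (p + q) * F (p - q)) / real_of_int (F p * F q)"
    and "w = e * (a / b) ^ 2"
  have w: "w \<noteq> 0" using e nz by (simp add: w_def)
  have "x = (a ^ 2 - e * b ^ 2) / (a * b)"
    unfolding x_def F_catalan by (simp add: a_def b_def e_def)
  then have x: "x = a / b - e * (b / a)"
    using nz by (simp add: field_simps power2_eq_square)
  \<comment> \<open>Since \<open>e * e = 1\<close>, the cross term becomes \<open>2\<close> and the
    last term becomes \<open>1 / w\<close>.\<close>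
  have "e * x ^ 2 = e * (a / b) ^ 2 - 2 * (e * e) * ((a / b) * (b / a)) + (e * e) * e * (b / a) ^ 2"
    unfolding x by (simp add: power2_eq_square algebra_simps)
  moreover have "1 / w = e * (b / a) ^ 2"
    using e(2) by (simp add: w_def divide_inverse power_mult_distrib power_inverse mult_ac)
  ultimately have y: "e * x ^ 2 = w - 2 + 1 / w"
    using nz by (simp add: ee w_def)
  \<comment> \<open>As \<open>e\<close> is its own inverse, the factor \<open>e ^ k\<close> can be
    merged with \<open>x ^ (2 * k)\<close> into \<open>(e * x ^ 2) ^ k\<close>.\<close>
  have sgn: "(-1) powi ((p - q) * (int n - int k)) = e ^ n * e ^ k" for k
  proof -
    have "(-1) powi ((p - q) * (int n - int k)) = e ^ n * inverse e ^ k"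
      unfolding power_int_mult e_def[symmetric]
      using e(1) by (simp add: power_int_diff divide_inverse power_inverse)
    then show ?thesis by (simp only: e(2))
  qed
  have "2 * (\<Sum>k=0..n. (-1) powi ((p - q) * (int n - int k)) * coef n k * x ^ (2 * k))
      = (\<Sum>k\<le>n. e ^ n * (real (lucas_coef n k) * (w - 2 + 1 / w) ^ k))"
    unfolding sum_distrib_left atMost_atLeast0
    by (intro sum.cong refl)
      (simp add: sgn power_mult power_mult_distrib flip: coef_eq_lucas_coef y)
  also have "\<dots> = e ^ n * (w ^ n + 1 / w ^ n)"
    unfolding sum_distrib_left[symmetric] lucas_poly_closed_form[OF w] ..
  \<comment> \<open>The outer \<open>e ^ n\<close> cancels against the one in
    \<open>1 / w ^ n\<close> and is squared to \<open>1\<close> in the other term.\<close>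
  also have "\<dots> = (e ^ n * e ^ n) * ((a / b) ^ 2) ^ n + 1 / ((a / b) ^ 2) ^ n"
    using e nz by (simp add: w_def power_mult_distrib distrib_left)
  also have "\<dots> = (a ^ (4 * n) + b ^ (4 * n)) / (b ^ (2 * n) * a ^ (2 * n))"
  proof -
    have "z ^ (4 * n) = z ^ (2 * n) * z ^ (2 * n)" for z :: real
      by (simp flip: power_add)
    then show ?thesis
      using e(3) nz by (simp add: power_divide field_simps flip: power_mult)
  qed
  finally show ?thesis by (simp add: x_def a_def b_def)
qed

end
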